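(* For natural numbers $n, m$ let $I_{n,m} := \int_0^1 x^n (1-x)^m e^x \, dx$. Let $(a_j)_{j\ge 1}$ be the sequence with $a_1 = 2$ and, for all $k \ge 1$, $a_{3k} = 2k$ and $a_{3k-1} = a_{3k+1} = 1$, so that $[a_1, a_2, a_3, \dots] = [2, 1, 2, 1, 1, 4, 1, 1, 6, 1, \dots]$. For $j \ge 1$ let $\frac{p_j}{q_j}$ (with $p_j, q_j \in \mathbb{N}$, $\gcd(p_j,q_j)=1$) be the $j$-th convergent $[a_1, \dots, a_j]$ of the regular continued fraction $[a_1, a_2, \dots]$; equivalently $p_1 = 2$, $q_1 = 1$, $p_2 = 3$, $q_2 = 1$, and $p_j = a_j p_{j-1} + p_{j-2}$, $q_j = a_j q_{j-1} + q_{j-2}$ for all $j \ge 3$. Then: (i) $I_{k,k} = (-1)^k k! \, (q_{3k-1} e - p_{3k-1})$ for all integers $k \ge 1$; (ii) $I_{k,k+1} = (-1)^k k! \, (q_{3k+1} e - p_{3k+1})$ for all integers $k \ge 0$; (iii) $I_{k+1,k} = (-1)^{k+1} k! \, (q_{3k} e - p_{3k})$ for all integers $k \ge 1$.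
   Context: Here $e = 2.71828\dots$ is the base of the natural logarithm and $\mathbb{N} = \{0,1,2,\dots\}$. *)

theory Defs
  imports "HOL-Analysis.Analysis"
begin

definition I_int :: "nat \<Rightarrow> nat \<Rightarrow> real" where
  "I_int n m = integral {0..1} (\<lambda>x::real. x ^ n * (1 - x) ^ m * exp x)"

text \<open>
  Value \<open>[x\<^sub>1, \<dots>, x\<^sub>r] = x\<^sub>1 + 1 / (x\<^sub>2 + 1 / (\<dots> + 1 / x\<^sub>r))\<close> of a finite continued fraction.
  The value of the empty list is a dummy. For positive entries no division by zero occurs.
\<close>
fun cfrac_val :: "nat list \<Rightarrow> real" where
  "cfrac_val [] = 0"
| "cfrac_val [x] = real x"
| "cfrac_val (x # y # ys) = real x + 1 / cfrac_val (y # ys)"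

definition convergent_val :: "(nat \<Rightarrow> nat) \<Rightarrow> nat \<Rightarrow> real" where
  "convergent_val a j = cfrac_val (map a [1..<Suc j])"

end

theory Submission
  imports Defs
begin

text \<open>
  The numerators \<open>P\<^sub>j\<close> and denominators \<open>Q\<^sub>j\<close> of the convergents satisfy the same three-term
  recursion, hence so does \<open>E\<^sub>j = Q\<^sub>j e - P\<^sub>j\<close>, and the recursion extends to \<open>j = 0\<close> with
  \<open>E\<^sub>0 = -1\<close>. On the other side, splitting \<open>1 = x + (1 - x)\<close> and integrating by parts give
  \<open>I\<^bsub>n,m\<^esub> = I\<^bsub>n+1,m\<^esub> + I\<^bsub>n,m+1\<^esub>\<close> and
  \<open>I\<^bsub>n+1,m+1\<^esub> = (m+1) I\<^bsub>n+1,m\<^esub> - (n+1) I\<^bsub>n,m+1\<^esub>\<close>. Near the diagonal, after division by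
  \<open>\<plusminus>k!\<close>, these two relations are the recursion for \<open>E\<close> with partial quotients \<open>1, 2k, 1\<close>.
  The initial values are \<open>I\<^bsub>1,0\<^esub> = 1 = -E\<^sub>0\<close> and \<open>I\<^bsub>0,1\<^esub> = e - 2 = E\<^sub>1\<close>.
\<close>

fun cfrac_num cfrac_den :: "nat list \<Rightarrow> nat" where
  "cfrac_num [] = 1"
| "cfrac_num (x # xs) = x * cfrac_num xs + cfrac_den xs"
| "cfrac_den [] = 0"
| "cfrac_den (x # xs) = cfrac_num xs"

text \<open>Convergents grow at the back, whereas continuants unfold at the front. A front entry
  acts linearly on the continuants of the two shorter tails, so a relation at the back survives
  prepending; hence the two-step induction.\<close>

lemma cfrac_num_append2:
  "cfrac_num (xs @ [x, y]) = y * cfrac_num (xs @ [x]) + cfrac_num xs"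
  and cfrac_den_append2:
  "cfrac_den (xs @ [x, y]) = y * cfrac_den (xs @ [x]) + cfrac_den xs"
proof (induction xs rule: induct_list012)
  case (3 u v xs)
  {
    case 1
    show ?case using 3 by (simp add: algebra_simps)
  next
    case 2
    show ?case using 3 by (simp add: algebra_simps)
  }
qed (simp_all add: algebra_simps)

text \<open>Prepending an entry is a Euclidean division step read backwards, which preserves the
  gcd.\<close>

lemma coprime_cfrac_num_den: "coprime (cfrac_num xs) (cfrac_den xs)"
proof (induction xs)
  case (Cons x xs)
  then show ?case
    using gcd_add_mult[of "cfrac_num xs" x "cfrac_den xs"]
    by (simp add: coprime_iff_gcd_eq_1 gcd.commute)
qed simp

lemma cfrac_num_pos: "(\<And>x. x \<in> set xs \<Longrightarrow> x > 0) \<Longrightarrow> cfrac_num xs > 0"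
  by (induction xs) auto

lemma cfrac_val_eq_num_div_den:
  assumes "xs \<noteq> []" and "\<And>x. x \<in> set xs \<Longrightarrow> x > 0"
  shows "cfrac_val xs = real (cfrac_num xs) / real (cfrac_den xs)"
  using assms
proof (induction xs rule: cfrac_val.induct)
  case (3 x y ys)
  have "cfrac_num (y # ys) > 0"
    by (rule cfrac_num_pos) (use 3 in auto)
  then have "real (cfrac_num (y # ys)) \<noteq> 0"
    by linarith
  moreover have "cfrac_val (y # ys) = real (cfrac_num (y # ys)) / real (cfrac_den (y # ys))"
    using 3 by simp
  ultimately show ?case
    by (simp only: cfrac_val.simps cfrac_num.simps(2)[of x] cfrac_den.simps(2)[of x])
      (simp add: field_simps del: cfrac_num.simps cfrac_den.simps)
qed auto

text \<open>Lowest terms are unique; this identifies the given \<open>p j\<close> and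
  \<open>q j\<close> with continuants.\<close>

lemma coprime_real_fraction_unique:
  fixes a b c d :: nat
  assumes "coprime a b" "coprime c d" "b > 0" "d > 0"
    and "real a / real b = real c / real d"
  shows "a = c" "b = d"
proof -
  have "real (a * d) = real (c * b)"
    using assms by (simp add: field_simps)
  then have "a * d = c * b"
    by (simp only: of_nat_eq_iff)
  with assms have "a = c \<and> d = b"
    using coprime_crossproduct_nat[of a b c d] by (simp add: mult.commute)
  then show "a = c" "b = d" by auto
qed

lemma I_int_integrable:
  "(\<lambda>x::real. x ^ n * (1 - x) ^ m * exp x) integrable_on {0..1}"
  by (intro integrable_continuous_interval continuous_intros)

lemma I_int_split: "I_int n m = I_int (Suc n) m + I_int n (Suc m)"
  unfolding I_int_def
  by (subst integral_add[symmetric, OF I_int_integrable I_int_integrable])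
    (auto intro!: integral_cong simp: algebra_simps)

text \<open>The function \<open>x ^ Suc n * (1 - x) ^ Suc m * exp x\<close> vanishes at 0 and 1, so
  its derivative \<open>?g\<close> integrates to 0.\<close>

lemma I_int_Suc_Suc:
  "I_int (Suc n) (Suc m) = real (Suc m) * I_int (Suc n) m - real (Suc n) * I_int n (Suc m)"
proof -
  let ?f = "\<lambda>n m (x::real). x ^ n * (1 - x) ^ m * exp x"
  let ?g = "\<lambda>x. real (Suc n) * ?f n (Suc m) x - real (Suc m) * ?f (Suc n) m x + ?f (Suc n) (Suc m) x"
  have "(?g has_integral ?f (Suc n) (Suc m) 1 - ?f (Suc n) (Suc m) 0) {0..1}"
  proof (rule fundamental_theorem_of_calculus)
    fix x :: real
    have "((\<lambda>x. x ^ Suc n) has_real_derivative real (Suc n) * x ^ n) (at x within {0..1})"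
      by (rule DERIV_cong[OF DERIV_power_Suc[OF DERIV_ident]]) simp
    moreover have "((\<lambda>x. (1 - x) ^ Suc m) has_real_derivative - (real (Suc m) * (1 - x) ^ m))
        (at x within {0..1})"
      by (rule DERIV_cong[OF DERIV_power_Suc[OF DERIV_diff[OF DERIV_const DERIV_ident]]]) simp
    moreover have "(exp has_real_derivative exp x) (at x within {0..1})"
      by (auto intro!: derivative_eq_intros)
    ultimately have "(?f (Suc n) (Suc m) has_real_derivative ?g x) (at x within {0..1})"
      by (rule DERIV_cong[OF DERIV_mult[OF DERIV_mult]]) (simp add: algebra_simps)
    then show "(?f (Suc n) (Suc m) has_vector_derivative ?g x) (at x within {0..1})"
      by (simp only: has_real_derivative_iff_has_vector_derivative)
  qed simp
  moreover have "(?g has_integral real (Suc n) * I_int n (Suc m)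
      - real (Suc m) * I_int (Suc n) m + I_int (Suc n) (Suc m)) {0..1}"
    unfolding I_int_def
    by (intro has_integral_add has_integral_diff has_integral_mult_right
        integrable_integral I_int_integrable)
  ultimately show ?thesis
    by (auto dest: has_integral_unique)
qed

lemma I_int_1_0: "I_int (Suc 0) 0 = 1"
proof -
  \<comment> \<open>The antiderivative is \<open>(x - 1) * exp x\<close>.\<close>
  have "((\<lambda>x::real. x * exp x) has_integral (1 - 1) * exp 1 - (0 - 1) * exp 0) {0..1}"
    by (rule fundamental_theorem_of_calculus)
      (auto intro!: derivative_eq_intros simp flip: has_real_derivative_iff_has_vector_derivative
        simp: algebra_simps)
  then show ?thesis
    unfolding I_int_def by (simp add: integral_unique)
qed

lemma I_int_0_1: "I_int 0 (Suc 0) = exp 1 - 2"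
proof -
  have "((\<lambda>x::real. exp x) has_integral exp 1 - exp 0) {0..1}"
    by (rule fundamental_theorem_of_calculus)
      (auto intro!: derivative_eq_intros simp flip: has_real_derivative_iff_has_vector_derivative)
  then have "I_int 0 0 = exp 1 - 1"
    unfolding I_int_def by (simp add: integral_unique)
  then show ?thesis
    using I_int_split[of 0 0] I_int_1_0 by simp
qed

text \<open>An abstract \<open>E\<close> separates the integrals from the continued fraction.
  Induction on \<open>k\<close> carries the two off-diagonal claims; the diagonal one follows from
  them at the same \<open>k\<close>.\<close>

lemma I_int_eq_three_term:
  fixes E :: "nat \<Rightarrow> real"
  assumes E0: "E 0 = -1" and E1: "E 1 = exp 1 - 2"
    and E2: "\<And>k. E (3 * k + 2) = E (3 * k + 1) + E (3 * k)"
    and E3: "\<And>k. E (3 * k + 3) = 2 * real (Suc k) * E (3 * k + 2) + E (3 * k + 1)"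
    and E4: "\<And>k. E (3 * k + 4) = E (3 * k + 3) + E (3 * k + 2)"
  shows "I_int (Suc k) k = (-1) ^ Suc k * fact k * E (3 * k)"
    and "I_int k (Suc k) = (-1) ^ k * fact k * E (3 * k + 1)"
    and "I_int (Suc k) (Suc k) = (-1) ^ Suc k * fact (Suc k) * E (3 * k + 2)"
proof -
  have diag: "I_int (Suc k) (Suc k) = (-1) ^ Suc k * fact (Suc k) * E (3 * k + 2)"
    if "I_int (Suc k) k = (-1) ^ Suc k * fact k * E (3 * k)"
      and "I_int k (Suc k) = (-1) ^ k * fact k * E (3 * k + 1)" for k
    unfolding I_int_Suc_Suc that E2 by (simp add: algebra_simps)
  have off_diag: "I_int (Suc k) k = (-1) ^ Suc k * fact k * E (3 * k) \<and>
      I_int k (Suc k) = (-1) ^ k * fact k * E (3 * k + 1)" for k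
  proof (induction k)
    case 0
    show ?case using E0 E1 by (simp add: I_int_1_0 I_int_0_1)
  next
    case (Suc k)
    note IH = Suc.IH[THEN conjunct1] Suc.IH[THEN conjunct2]
    note D = diag[OF IH]
    \<comment> \<open>Splitting eliminates \<open>I_int (Suc (Suc k)) k\<close>, which lies too far
      from the diagonal for the induction hypothesis.\<close>
    have "I_int (Suc (Suc k)) (Suc k) =
        real (Suc k) * (I_int (Suc k) k - I_int (Suc k) (Suc k))
        - real (Suc (Suc k)) * I_int (Suc k) (Suc k)"
      using I_int_Suc_Suc[of "Suc k" k] I_int_split[of "Suc k" k] by simp
    \<comment> \<open>The diagonal relation replaces \<open>I_int (Suc k) k\<close>; the diagonal
      coefficients then add up to -2(k+1), the source of the partial quotient 2(k+1).\<close>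
    also have "\<dots> = real (Suc k) * I_int k (Suc k) - 2 * real (Suc k) * I_int (Suc k) (Suc k)"
      using I_int_Suc_Suc[of k k] by (simp add: algebra_simps)
    also have "\<dots> = (-1) ^ Suc (Suc k) * fact (Suc k) * E (3 * k + 3)"
      unfolding D IH E3 by (simp add: algebra_simps)
    finally have lower: "I_int (Suc (Suc k)) (Suc k) =
      (-1) ^ Suc (Suc k) * fact (Suc k) * E (3 * k + 3)" .
    have "I_int (Suc k) (Suc (Suc k)) = I_int (Suc k) (Suc k) - I_int (Suc (Suc k)) (Suc k)"
      using I_int_split[of "Suc k" "Suc k"] by simp
    also have "\<dots> = (-1) ^ Suc k * fact (Suc k) * E (3 * k + 4)"
      unfolding D lower E4 by (simp add: algebra_simps)
    finally have "I_int (Suc k) (Suc (Suc k)) = (-1) ^ Suc k * fact (Suc k) * E (3 * k + 4)" .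
    moreover have "3 * Suc k = 3 * k + 3" "3 * Suc k + 1 = 3 * k + 4"
      by simp_all
    ultimately show ?case
      using lower by metis
  qed
  show "I_int (Suc k) k = (-1) ^ Suc k * fact k * E (3 * k)"
    and "I_int k (Suc k) = (-1) ^ k * fact k * E (3 * k + 1)"
    and "I_int (Suc k) (Suc k) = (-1) ^ Suc k * fact (Suc k) * E (3 * k + 2)"
    using off_diag[of k] diag[of k] by blast+
qed

theorem theorem1:
  fixes a p q :: "nat \<Rightarrow> nat"
  assumes "a 1 = 2"
    and "\<forall>k\<ge>1. a (3 * k) = 2 * k \<and> a (3 * k - 1) = 1 \<and> a (3 * k + 1) = 1"
    and "\<forall>j\<ge>1. q j > 0 \<and> coprime (p j) (q j) \<and> real (p j) / real (q j) = convergent_val a j"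
  shows "(\<forall>k\<ge>1. I_int k k =
             (-1) ^ k * fact k * (real (q (3 * k - 1)) * exp 1 - real (p (3 * k - 1))))
       \<and> (\<forall>k. I_int k (k + 1) =
             (-1) ^ k * fact k * (real (q (3 * k + 1)) * exp 1 - real (p (3 * k + 1))))
       \<and> (\<forall>k\<ge>1. I_int (k + 1) k =
             (-1) ^ (k + 1) * fact k * (real (q (3 * k)) * exp 1 - real (p (3 * k))))"
proof -
  \<comment> \<open>Shifting \<open>k\<close> by one removes the natural subtraction in
    \<open>3 * k - 1\<close>.\<close>
  have a2: "a (3 * k + 2) = 1" and a3: "a (3 * k + 3) = 2 * Suc k" and a4: "a (3 * k + 4) = 1" for k
    using assms(2)[rule_format, of "Suc k"] by (simp_all add: numeral_eq_Suc)
  have a_pos: "a j > 0" if "j \<ge> 1" for j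
  proof -
    have "j = 1 \<or> (\<exists>k. j = 3 * k + 2 \<or> j = 3 * k + 3 \<or> j = 3 * k + 4)"
      using that by presburger
    then consider "j = 1" | k where "j = 3 * k + 2" | k where "j = 3 * k + 3" | k where "j = 3 * k + 4"
      by blast
    then show ?thesis
      by cases (simp_all only: a2 a3 a4 assms(1) zero_less_one zero_less_Suc zero_less_numeral nat_0_less_mult_iff)
  qed
  define L where "L j = map a [1..<Suc j]" for j
  \<comment> \<open>Continuants rather than \<open>p\<close> and \<open>q\<close>, whose values at 0
    are unconstrained: \<open>L 0 = []\<close> gives \<open>E 0 = -1\<close>.\<close>
  define E where "E j = real (cfrac_den (L j)) * exp 1 - real (cfrac_num (L j))" for j
  have L_Suc: "L (Suc j) = L j @ [a (Suc j)]" for j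
    by (simp add: L_def)
  have E_rec: "E (Suc (Suc j)) = real (a (Suc (Suc j))) * E (Suc j) + E j" for j
    by (simp add: E_def L_Suc cfrac_num_append2 cfrac_den_append2 algebra_simps)
  have pq: "p j = cfrac_num (L j)" "q j = cfrac_den (L j)" if "j \<ge> 1" for j
  proof -
    have L_pos: "x > 0" if "x \<in> set (L j)" for x
      using that a_pos by (auto simp: L_def)
    have "L j \<noteq> []" using \<open>j \<ge> 1\<close> by (simp add: L_def)
    then have val: "real (p j) / real (q j) = real (cfrac_num (L j)) / real (cfrac_den (L j))"
      using assms(3) that cfrac_val_eq_num_div_den[of "L j", OF _ L_pos]
      unfolding convergent_val_def L_def[symmetric] by simp
    obtain x xs where x: "L j = x # xs"
      using \<open>L j \<noteq> []\<close> by (cases "L j") auto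
    have "cfrac_den (L j) > 0"
      using L_pos cfrac_num_pos[of xs] by (simp add: x)
    then show "p j = cfrac_num (L j)" "q j = cfrac_den (L j)"
      using coprime_real_fraction_unique[OF _ coprime_cfrac_num_den _ _ val] assms(3) that by auto
  qed
  have E_eq: "E j = real (q j) * exp 1 - real (p j)" if "j \<ge> 1" for j
    using pq[OF that] by (simp add: E_def)
  have E0: "E 0 = -1" and E1: "E 1 = exp 1 - 2"
    using assms(1) by (simp_all add: E_def L_def)
  have E2: "E (3 * k + 2) = E (3 * k + 1) + E (3 * k)" for k
    using E_rec[of "3 * k"] a2[of k] by simp
  have E3: "E (3 * k + 3) = 2 * real (Suc k) * E (3 * k + 2) + E (3 * k + 1)" for k
    using E_rec[of "3 * k + 1"] a3[of k] by (simp add: numeral_eq_Suc)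
  have E4: "E (3 * k + 4) = E (3 * k + 3) + E (3 * k + 2)" for k
    using E_rec[of "3 * k + 2"] a4[of k] by (simp add: numeral_eq_Suc)
  note I = I_int_eq_three_term[of E, OF E0 E1 E2 E3 E4]
  show ?thesis
  proof (intro conjI allI impI)
    fix k :: nat assume "k \<ge> 1"
    then obtain l where l: "k = Suc l"
      by (cases k) auto
    have "3 * k - 1 = 3 * l + 2"
      using l by simp
    then show "I_int k k = (-1) ^ k * fact k * (real (q (3 * k - 1)) * exp 1 - real (p (3 * k - 1)))"
      using I(3)[of l] E_eq[of "3 * l + 2"] l by (metis le_add2 one_le_numeral order_trans)
  next
    fix k :: nat
    show "I_int k (k + 1) = (-1) ^ k * fact k * (real (q (3 * k + 1)) * exp 1 - real (p (3 * k + 1)))"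
      using I(2)[of k] E_eq[of "3 * k + 1"] by simp
  next
    fix k :: nat assume "k \<ge> 1"
    then show "I_int (k + 1) k = (-1) ^ (k + 1) * fact k * (real (q (3 * k)) * exp 1 - real (p (3 * k)))"
      using I(1)[of k] E_eq[of "3 * k"] by simp
  qed
qed

end
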